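(* Let $k$ and $p$ be positive integers. Every $k$-degenerate ordered graph $\mathcal{G}$ with $n$ vertices and interval chromatic number $p$ satisfies \[\overline{R}(\mathcal{G};2)\le n^{(1+2/k)(k+1)^{\lceil \log p\rceil}-2/k}.\]
   Context: Logarithms are base 2. An ordered graph is a finite simple graph with a total ordering $\prec$ of its vertices; a copy of an ordered graph in another is given by an edge-preserving injection that preserves the orderings. A graph is $k$-degenerate if every subgraph has a vertex of degree at most $k$ (equivalently, its vertices can be ordered so that each vertex has at most $k$ neighbors preceding it in that ordering). A set $I$ of vertices is an interval of $\prec$ if $u,v\in I$ and $u\prec w\prec v$ imply $w\in I$. The interval chromatic number of an ordered graph is the minimum number of intervals into which its vertex set can be partitioned so that no edge has both endpoints in the same interval. $\mathcal{K}_N$ is the complete graph on $N$ totally ordered vertices and $\overline{R}(\mathcal{G};2)$ is the smallest $N$ such that every 2-coloring of the edges of $\mathcal{K}_N$ contains a monochromatic copy of $\mathcal{G}$. *)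

theory Defs
  imports Complex_Main "HOL-Library.Ramsey" "HOL-Library.Disjoint_Sets" "HOL-Library.FuncSet"
begin

text \<open>
  The vertex order of an ordered graph is the order of the vertex type \<open>'a::linorder\<close>, restricted
  to the vertex set \<open>V\<close>. Edges are two-element vertex sets; \<open>[V]\<^bsup>2\<^esup>\<close> is the set of all of them.
\<close>

locale ordered_graph =
  fixes V :: "'a::linorder set" and E :: "'a set set"
  assumes finite_vertices: "finite V"
    and edges_subset: "E \<subseteq> [V]\<^bsup>2\<^esup>"

definition degree :: "'a set set \<Rightarrow> 'a \<Rightarrow> nat" where
  "degree E v = card {e \<in> E. v \<in> e}"

text \<open>Only subgraphs with at least one vertex are considered.\<close>

definition degenerate :: "nat \<Rightarrow> 'a set \<Rightarrow> 'a set set \<Rightarrow> bool" where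
  "degenerate k V E \<longleftrightarrow>
    (\<forall>W F. W \<subseteq> V \<longrightarrow> W \<noteq> {} \<longrightarrow> F \<subseteq> E \<longrightarrow> F \<subseteq> [W]\<^bsup>2\<^esup> \<longrightarrow> (\<exists>v\<in>W. degree F v \<le> k))"

definition vertex_interval :: "'a::linorder set \<Rightarrow> 'a set \<Rightarrow> bool" where
  "vertex_interval V I \<longleftrightarrow>
    I \<subseteq> V \<and> (\<forall>u\<in>I. \<forall>v\<in>I. \<forall>w\<in>V. u < w \<longrightarrow> w < v \<longrightarrow> w \<in> I)"

definition interval_colouring :: "'a::linorder set \<Rightarrow> 'a set set \<Rightarrow> 'a set set \<Rightarrow> bool" where
  "interval_colouring V E P \<longleftrightarrow>
    partition_on V P \<and> (\<forall>I\<in>P. vertex_interval V I \<and> (\<forall>e\<in>E. \<not> e \<subseteq> I))"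

definition interval_chromatic_number :: "'a::linorder set \<Rightarrow> 'a set set \<Rightarrow> nat" where
  "interval_chromatic_number V E = (LEAST m. \<exists>P. interval_colouring V E P \<and> card P = m)"

definition ordered_copy ::
  "('a::linorder \<Rightarrow> 'b::linorder) \<Rightarrow> 'a set \<Rightarrow> 'a set set \<Rightarrow> 'b set \<Rightarrow> 'b set set \<Rightarrow> bool" where
  "ordered_copy f V E W F \<longleftrightarrow>
    f \<in> V \<rightarrow> W \<and> inj_on f V \<and> strict_mono_on V f \<and> (\<forall>e\<in>E. f ` e \<in> F)"

text \<open>
  The complete ordered graph on \<open>N\<close> vertices has vertex set \<open>{..<N}\<close> and edge set
  \<open>[{..<N}]\<^bsup>2\<^esup>\<close>; a \<open>q\<close>-colouring of it uses the colours \<open>{..<q}\<close>.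
\<close>

definition ordered_ramsey_arrow :: "nat \<Rightarrow> 'a::linorder set \<Rightarrow> 'a set set \<Rightarrow> nat \<Rightarrow> bool" where
  "ordered_ramsey_arrow N V E q \<longleftrightarrow>
    (\<forall>\<chi> \<in> [{..<N}]\<^bsup>2\<^esup> \<rightarrow> {..<q}.
      \<exists>f. \<exists>c<q. ordered_copy f V E {..<N} ([{..<N}]\<^bsup>2\<^esup>) \<and> (\<forall>e\<in>E. \<chi> (f ` e) = c))"

definition ordered_ramsey_number :: "'a::linorder set \<Rightarrow> 'a set set \<Rightarrow> nat \<Rightarrow> nat" where
  "ordered_ramsey_number V E q = (LEAST N. ordered_ramsey_arrow N V E q)"

end

theory Submission
  imports Defs
begin

text \<open>
  If a two-coloured complete graph on \<open>n\<^sup>2 M\<^sup>k\<^sup>+\<^sup>1\<close> vertices has no blue copy of a \<open>k\<close>-degenerate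
  graph on \<open>n\<close> vertices, then it has sets \<open>A < B\<close> of size \<open>M\<close> with only red edges between them:
  otherwise the graph embeds greedily along its degeneracy order, the candidate set of a vertex
  shrinking by a factor of at most \<open>M\<close> whenever one of its at most \<open>k\<close> earlier neighbours is
  embedded. Iterating inside \<open>A\<close> and \<open>B\<close>, starting from \<open>M = n\<close>, yields a red complete
  \<open>2\<^sup>L\<close>-partite graph with interval parts of size \<open>n\<close>, which contains every \<open>n\<close>-vertex graph of
  interval chromatic number at most \<open>2\<^sup>L\<close>. The exponents of \<open>n\<close> satisfy \<open>e\<^sub>0 = 1\<close> and
  \<open>e\<^sub>L\<^sub>+\<^sub>1 = (k + 1) e\<^sub>L + 2\<close>.
\<close>

section \<open>Degeneracy orders\<close>

lemma degenerate_subgraph: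
  assumes "degenerate k V E" "W \<subseteq> V" "F \<subseteq> E"
  shows "degenerate k W F"
  unfolding degenerate_def
proof (intro allI impI)
  fix U G assume "U \<subseteq> W" "U \<noteq> {}" "G \<subseteq> F" "G \<subseteq> [U]\<^bsup>2\<^esup>"
  then show "\<exists>v\<in>U. degree G v \<le> k"
    using assms(1)[unfolded degenerate_def, rule_format, of U G] assms(2,3) by (simp add: subset_trans)
qed

text \<open>A vertex of degree at most \<open>k\<close> is removed and ranked last, and the
  remaining graph is ranked by induction. The rank \<open>r\<close> is unrelated to the vertex order
  of an ordered graph. It only fixes the order in which vertices are embedded.\<close>

lemma degeneracy_order:
  fixes V :: "'a set"
  assumes "finite V" "E \<subseteq> [V]\<^bsup>2\<^esup>" "degenerate k V E"
  shows "\<exists>r. bij_betw r V {..<card V} \<and> (\<forall>v\<in>V. card {u\<in>V. {u, v} \<in> E \<and> r u < r v} \<le> k)"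
  using assms
proof (induction "card V" arbitrary: V E)
  case 0
  then show ?case by (auto simp: bij_betw_def)
next
  case (Suc m)
  have "V \<noteq> {}" using Suc.hyps(2) by auto
  then obtain v where v: "v \<in> V" "degree E v \<le> k"
    using Suc.prems unfolding degenerate_def by blast
  let ?W = "V - {v}" and ?F = "{e\<in>E. v \<notin> e}"
  have m: "m = card ?W" using Suc.hyps(2) v Suc.prems(1) by simp
  have "?F \<subseteq> [?W]\<^bsup>2\<^esup>" using Suc.prems(2) by (auto simp: nsets_def)
  then obtain r where r: "bij_betw r ?W {..<card ?W}"
    and rk: "\<And>w. w \<in> ?W \<Longrightarrow> card {u\<in>?W. {u, w} \<in> ?F \<and> r u < r w} \<le> k"
    using Suc.hyps(1)[OF m, of ?F] Suc.prems degenerate_subgraph[OF Suc.prems(3), of ?W ?F]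
    by auto
  have r_less: "r w < m" if "w \<in> ?W" for w
    using r that m unfolding bij_betw_def by blast
  define s where "s = r(v := m)"
  have "bij_betw s ?W {..<m}"
    using r m unfolding s_def by (subst bij_betw_cong[where g = r]) auto
  then have "bij_betw s (insert v ?W) (insert m {..<m})"
    unfolding bij_betw_def by (auto simp: s_def inj_on_def)
  moreover have "insert v ?W = V" "insert m {..<m} = {..<card V}"
    using v Suc.hyps(2) by auto
  ultimately have bij: "bij_betw s V {..<card V}" by simp
  have "card {u\<in>V. {u, w} \<in> E \<and> s u < s w} \<le> k" if "w \<in> V" for w
  proof (cases "w = v")
    case True
    have finE: "finite E" using Suc.prems finite_subset finite_imp_finite_nsets by blast
    \<comment> \<open>The neighbours \<open>u\<close> of \<open>v\<close> inject into the edges at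
      \<open>v\<close> by \<open>{u, v}\<close>.\<close>
    have "card {u\<in>V. {u, w} \<in> E \<and> s u < s w} \<le> card {e\<in>E. v \<in> e}"
      by (rule card_inj_on_le[where f = "\<lambda>u. {u, v}"])
        (use True finE in \<open>auto simp: inj_on_def doubleton_eq_iff\<close>)
    then show ?thesis using v by (simp add: degree_def)
  next
    case False
    \<comment> \<open>Since \<open>v\<close> has the largest rank, it is an earlier neighbour of no
      other vertex.\<close>
    have "{u\<in>V. {u, w} \<in> E \<and> s u < s w} = {u\<in>?W. {u, w} \<in> ?F \<and> r u < r w}"
      using False that r_less[of w] by (auto simp: s_def)
    then show ?thesis using rk[of w] False that by simp
  qed
  then show ?case using bij by blast
qed

section \<open>Consecutive blocks in a linear order\<close>

lemma obtain_initial_segment: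
  fixes S :: "'b::linorder set"
  assumes "finite S" "m \<le> card S"
  obtains A where "A \<subseteq> S" "card A = m" "\<And>a b. a \<in> A \<Longrightarrow> b \<in> S - A \<Longrightarrow> a < b"
  using assms
proof (induction m arbitrary: thesis)
  case 0
  show ?case by (rule 0(1)[of "{}"]) auto
next
  case (Suc m)
  obtain A where A: "A \<subseteq> S" "card A = m" "\<And>a b. a \<in> A \<Longrightarrow> b \<in> S - A \<Longrightarrow> a < b"
    using Suc by (metis Suc_leD)
  have fin: "finite A" using A(1) Suc.prems(2) finite_subset by blast
  have ne: "S - A \<noteq> {}" using A Suc.prems(3) by (metis Diff_eq_empty_iff Suc_n_not_le_n subset_antisym)
  let ?x = "Min (S - A)"
  have x: "?x \<in> S - A" using ne Suc.prems(2) by (intro Min_in) auto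
  have min: "?x \<le> b" if "b \<in> S - A" for b using that Suc.prems(2) by (intro Min_le) auto
  show ?case
  proof (rule Suc.prems(1)[of "insert ?x A"])
    show "a < b" if "a \<in> insert ?x A" "b \<in> S - insert ?x A" for a b
      using that A(3)[of a b] min[of b] by auto
  qed (use A x fin in auto)
qed

text \<open>The largest vertex \<open>b\<close> takes its block from what remains of
  \<open>S\<close> after an initial segment reserved for all other vertices. Any choice of one point
  per block is then strictly increasing, so order preservation need not be tracked during an
  embedding.\<close>

lemma consecutive_blocks:
  fixes V :: "'a::linorder set" and S :: "'b::linorder set"
  assumes "finite V" "finite S" "card V * m \<le> card S"
  shows "\<exists>I. (\<forall>v\<in>V. I v \<subseteq> S \<and> card (I v) = m) \<and>
    (\<forall>u\<in>V. \<forall>v\<in>V. u < v \<longrightarrow> (\<forall>x\<in>I u. \<forall>y\<in>I v. x < y))"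
  using assms
proof (induction V arbitrary: S rule: finite_linorder_max_induct)
  case empty
  then show ?case by simp
next
  case (insert b V)
  have b: "b \<notin> V" using insert.hyps by blast
  have card: "card V * m + m \<le> card S"
    using insert.prems insert.hyps(1) b by simp
  then obtain A where A: "A \<subseteq> S" "card A = card V * m"
      "\<And>a b. a \<in> A \<Longrightarrow> b \<in> S - A \<Longrightarrow> a < b"
    using obtain_initial_segment[OF insert.prems(1), of "card V * m"] by auto
  have finA: "finite A" using A(1) insert.prems(1) finite_subset by blast
  obtain I where I: "\<forall>v\<in>V. I v \<subseteq> A \<and> card (I v) = m"
      "\<forall>u\<in>V. \<forall>v\<in>V. u < v \<longrightarrow> (\<forall>x\<in>I u. \<forall>y\<in>I v. x < y)"
    using insert.IH[OF finA] A(2) by auto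
  have "m \<le> card (S - A)" using card A finA by (simp add: card_Diff_subset)
  then obtain B where B: "B \<subseteq> S - A" "card B = m" by (meson obtain_subset_with_card_n)
  have "x < y" if "u \<in> insert b V" "v \<in> insert b V" "u < v" "x \<in> (I(b := B)) u" "y \<in> (I(b := B)) v"
    for u v x y
  proof -
    have "u \<in> V" "u \<noteq> b" using that insert.hyps(2) by force+
    then have x: "x \<in> I u" "x \<in> A" using that(4) I(1) by auto
    show ?thesis
    proof (cases "v = b")
      case True
      then show ?thesis using x A(3) B(1) that(5) by auto
    next
      case False
      then show ?thesis using x I(2) \<open>u \<in> V\<close> that by auto
    qed
  qed
  moreover have "\<forall>v\<in>insert b V. (I(b := B)) v \<subseteq> S \<and> card ((I(b := B)) v) = m"
    using I(1) A(1) B b by auto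
  ultimately show ?case by blast
qed

section \<open>Greedy embedding or an empty pair\<close>

text \<open>If \<open>M\<close> vertices of \<open>C\<close> had at most \<open>m - 1\<close>
  neighbours each in \<open>D\<close>, together they would reach at most \<open>m * M - M\<close>
  vertices of \<open>D\<close>. The \<open>M\<close> or more vertices left over would contain a set
  \<open>B\<close> with no \<open>Q\<close>-edge to these \<open>M\<close> vertices.\<close>

lemma few_vertices_of_small_degree:
  fixes Q :: "'b set \<Rightarrow> bool"
  assumes "finite C" "finite D" "m * M \<le> card D"
    and no_pair: "\<And>A B. A \<subseteq> C \<Longrightarrow> B \<subseteq> D \<Longrightarrow> card A = M \<Longrightarrow> card B = M \<Longrightarrow> \<exists>a\<in>A. \<exists>b\<in>B. Q {a, b}"
    and "M > 0"
  shows "card {x\<in>C. card {y\<in>D. Q {x, y}} < m} < M"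
proof (rule ccontr)
  assume "\<not> ?thesis"
  then obtain A where A: "A \<subseteq> {x\<in>C. card {y\<in>D. Q {x, y}} < m}" "card A = M"
    by (meson not_less obtain_subset_with_card_n)
  have finA: "finite A" "A \<noteq> {}" using A(2) \<open>M > 0\<close> card_gt_0_iff by force+
  let ?U = "\<Union>x\<in>A. {y\<in>D. Q {x, y}}"
  have "m > 0" using A(1) finA by fastforce
  have "card ?U \<le> (\<Sum>x\<in>A. card {y\<in>D. Q {x, y}})" using finA by (intro card_UN_le)
  also have "\<dots> \<le> (\<Sum>x\<in>A. m - 1)" using A(1) by (intro sum_mono) auto
  finally have "card ?U \<le> M * (m - 1)" using A(2) by simp
  moreover have "M * (m - 1) + M = m * M" using \<open>m > 0\<close> by (cases m) auto
  moreover have "card (D - ?U) = card D - card ?U"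
    using assms(2) by (intro card_Diff_subset) (auto intro: finite_subset[OF _ assms(2)])
  ultimately have "M \<le> card (D - ?U)" using assms(3) by linarith
  then obtain B where B: "B \<subseteq> D - ?U" "card B = M" by (meson obtain_subset_with_card_n)
  then obtain a b where "a \<in> A" "b \<in> B" "Q {a, b}" using no_pair[of A B] A by blast
  then show False using B by blast
qed

text \<open>Vertices are embedded in degeneracy order. A vertex with \<open>d\<close> embedded
  neighbours keeps at least \<open>card V * M ^ (k + 1 - d)\<close> candidates. As \<open>d\<close>
  never exceeds \<open>k\<close>, a factor \<open>M\<close> survives until its turn; the factor
  \<open>card V\<close> pays for the choices spoiled by each of its later neighbours.\<close>

lemma greedy_embedding:
  fixes V :: "'a set" and I :: "'a \<Rightarrow> 'b set" and Q :: "'b set \<Rightarrow> bool"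
  assumes "finite V" "E \<subseteq> [V]\<^bsup>2\<^esup>" "degenerate k V E" "M > 0"
    and I: "\<And>v. v \<in> V \<Longrightarrow> finite (I v)" "\<And>v. v \<in> V \<Longrightarrow> card V * M ^ (k + 1) \<le> card (I v)"
    and no_pair: "\<And>u v A B. u \<in> V \<Longrightarrow> v \<in> V \<Longrightarrow> u \<noteq> v \<Longrightarrow> A \<subseteq> I u \<Longrightarrow> B \<subseteq> I v \<Longrightarrow>
      card A = M \<Longrightarrow> card B = M \<Longrightarrow> \<exists>a\<in>A. \<exists>b\<in>B. Q {a, b}"
  shows "\<exists>f. (\<forall>v\<in>V. f v \<in> I v) \<and> (\<forall>u\<in>V. \<forall>v\<in>V. {u, v} \<in> E \<longrightarrow> Q {f u, f v})"
proof -
  obtain r where bij: "bij_betw r V {..<card V}"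
    and rk: "\<And>v. v \<in> V \<Longrightarrow> card {u\<in>V. {u, v} \<in> E \<and> r u < r v} \<le> k"
    using degeneracy_order[OF assms(1-3)] by blast
  define d where "d i v = card {u\<in>V. {u, v} \<in> E \<and> r u < i}" for i v
  have r_eq: "u = v" if "u \<in> V" "v \<in> V" "r u = r v" for u v
    using bij that unfolding bij_betw_def inj_on_def by blast
  have no_loop: "{v, v} \<notin> E" for v
    using assms(2) by (auto simp: nsets_def)
  \<comment> \<open>The state after the vertices of rank below \<open>i\<close> are placed by
    \<open>f\<close>. The last clause makes every remaining candidate compatible with all embedded
    neighbours, so any candidate may be chosen as far as earlier edges are concerned.\<close>
  define partial_emb where "partial_emb i f C \<longleftrightarrow>
      (\<forall>v\<in>V. r v < i \<longrightarrow> f v \<in> I v) \<and>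
      (\<forall>u\<in>V. \<forall>v\<in>V. {u, v} \<in> E \<longrightarrow> r u < i \<longrightarrow> r v < i \<longrightarrow> Q {f u, f v}) \<and>
      (\<forall>v\<in>V. i \<le> r v \<longrightarrow> C v \<subseteq> I v \<and> card V * M ^ (k + 1 - d i v) \<le> card (C v)) \<and>
      (\<forall>u\<in>V. \<forall>v\<in>V. {u, v} \<in> E \<longrightarrow> r u < i \<longrightarrow> i \<le> r v \<longrightarrow> (\<forall>x\<in>C v. Q {f u, x}))"
    for i f and C :: "'a \<Rightarrow> 'b set"
  have "\<exists>f C. partial_emb i f C" if "i \<le> card V" for i
    using that
  proof (induction i)
    case 0
    have "partial_emb 0 f I" for f
      using I(2) unfolding partial_emb_def d_def by simp
    then show ?case by blast
  next
    case (Suc i)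
    then obtain f C where partial_emb: "partial_emb i f C" by auto
    have "i \<in> r ` V" using bij Suc.prems unfolding bij_betw_def by auto
    then obtain v where v: "v \<in> V" "r v = i" by blast
    have C: "C u \<subseteq> I u" "finite (C u)" "card V * M ^ (k + 1 - d i u) \<le> card (C u)"
      if "u \<in> V" "i \<le> r u" for u
      using partial_emb that I(1)[of u] finite_subset[of "C u" "I u"] unfolding partial_emb_def by blast+
    \<comment> \<open>These later neighbours of \<open>v\<close> are the only vertices whose
      candidate sets shrink in this step.\<close>
    define L where "L = {u\<in>V. {v, u} \<in> E \<and> i < r u}"
    \<comment> \<open>The inequality is strict because \<open>v\<close> itself is an earlier
      neighbour of \<open>u\<close> that \<open>d i u\<close> does not count yet. Hence the natural
      subtraction \<open>k - d i u\<close> is exact.\<close>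
    have d_L: "d (Suc i) u = Suc (d i u)" "d i u < k" if "u \<in> L" for u
    proof -
      have "{w\<in>V. {w, u} \<in> E \<and> r w < Suc i} = insert v {w\<in>V. {w, u} \<in> E \<and> r w < i}"
        using that v r_eq unfolding L_def by (auto simp: less_Suc_eq)
      then show 1: "d (Suc i) u = Suc (d i u)"
        unfolding d_def using v \<open>finite V\<close> by simp
      have "d (Suc i) u \<le> card {w\<in>V. {w, u} \<in> E \<and> r w < r u}"
        unfolding d_def using that \<open>finite V\<close> by (intro card_mono) (auto simp: L_def)
      also have "\<dots> \<le> k" using that rk by (simp add: L_def)
      finally show "d i u < k" using 1 by simp
    qed
    have d_other: "d (Suc i) u = d i u" if "u \<in> V" "i < r u" "u \<notin> L" for u
    proof -
      have "{w\<in>V. {w, u} \<in> E \<and> r w < Suc i} = {w\<in>V. {w, u} \<in> E \<and> r w < i}"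
        using that v r_eq unfolding L_def by (auto simp: less_Suc_eq)
      then show ?thesis by (simp add: d_def)
    qed
    \<comment> \<open>The choices \<open>x\<close> for \<open>v\<close> that would leave
      \<open>u\<close> fewer candidates than the invariant demands at stage
      \<open>Suc i\<close>.\<close>
    let ?bad = "\<lambda>u. {x\<in>C v. card {y\<in>C u. Q {x, y}} < card V * M ^ (k - d i u)}"
    have bad: "card (?bad u) \<le> M - 1" if "u \<in> L" for u
    proof -
      have u: "u \<in> V" "i < r u" "u \<noteq> v" using that v by (auto simp: L_def)
      have "k + 1 - d i u = Suc (k - d i u)" using d_L(2)[OF that] by simp
      then have "card V * M ^ (k - d i u) * M \<le> card (C u)"
        using C(3)[of u] u by (simp add: mult_ac)
      moreover have "\<exists>a\<in>A. \<exists>b\<in>B. Q {a, b}"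
        if "A \<subseteq> C v" "B \<subseteq> C u" "card A = M" "card B = M" for A B
        using no_pair[of v u A B] that C(1)[of u] C(1)[of v] u v by auto
      ultimately have "card (?bad u) < M"
        using C(2)[of u] C(2)[of v] u v \<open>M > 0\<close> by (intro few_vertices_of_small_degree) auto
      then show ?thesis by simp
    qed
    have finL: "finite L" using \<open>finite V\<close> by (simp add: L_def)
    \<comment> \<open>Each later neighbour spoils at most \<open>M - 1\<close> choices, so fewer
      than \<open>card V * M\<close> are spoiled in all, while \<open>C v\<close> has at least that
      many elements because \<open>d i v\<close> is at most \<open>k\<close>.\<close>
    have "card (\<Union>u\<in>L. ?bad u) \<le> (\<Sum>u\<in>L. card (?bad u))"
      using finL by (intro card_UN_le)
    also have "\<dots> \<le> (\<Sum>u\<in>L. M - 1)" using bad by (intro sum_mono)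
    also have "\<dots> = card L * (M - 1)" by simp
    also have "\<dots> \<le> card V * (M - 1)"
      using \<open>finite V\<close> by (intro mult_right_mono card_mono) (auto simp: L_def)
    also have "\<dots> < card V * M"
      using v \<open>finite V\<close> \<open>M > 0\<close> card_gt_0_iff by (intro mult_strict_left_mono) auto
    also have "\<dots> \<le> card V * M ^ (k + 1 - d i v)"
    proof -
      have "d i v \<le> k" using rk[of v] v unfolding d_def by simp
      then have "M ^ 1 \<le> M ^ (k + 1 - d i v)" using \<open>M > 0\<close> by (intro power_increasing) auto
      then show ?thesis by simp
    qed
    also have "\<dots> \<le> card (C v)" using C(3)[of v] v by simp
    finally have "\<not> C v \<subseteq> (\<Union>u\<in>L. ?bad u)"
      using card_mono[of "\<Union>u\<in>L. ?bad u" "C v"] finL C(2)[of v] v by auto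
    then obtain x where x: "x \<in> C v" "x \<notin> (\<Union>u\<in>L. ?bad u)" by (meson subsetI)
    have good: "card V * M ^ (k - d i u) \<le> card {y\<in>C u. Q {x, y}}" if "u \<in> L" for u
    proof (rule ccontr)
      assume "\<not> ?thesis"
      then have "x \<in> ?bad u" using x(1) by (simp add: not_le)
      then have "x \<in> (\<Union>u\<in>L. ?bad u)" by (rule UN_I[OF that])
      with x(2) show False by (rule notE)
    qed
    define g where "g = f(v := x)"
    define D where "D u = (if u \<in> L then {y\<in>C u. Q {x, y}} else C u)" for u
    have g_old: "g u = f u" if "r u < i" for u using that v by (auto simp: g_def)
    have cases: "r u < i \<or> u = v" if "u \<in> V" "r u < Suc i" for u
      using that v r_eq by (auto simp: less_Suc_eq)
    have "partial_emb (Suc i) g D"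
      unfolding partial_emb_def
    proof (intro conjI ballI impI)
      fix u assume u: "u \<in> V" "r u < Suc i"
      show "g u \<in> I u"
      proof (cases "u = v")
        case True
        then show ?thesis using x C(1)[of v] v by (auto simp: g_def)
      next
        case False
        then have "r u < i" using cases u by blast
        then show ?thesis using partial_emb u(1) g_old unfolding partial_emb_def by simp
      qed
    next
      fix u w assume uw: "u \<in> V" "w \<in> V" "{u, w} \<in> E" "r u < Suc i" "r w < Suc i"
      have "u \<noteq> w" using uw(3) no_loop by auto
      then consider "r u < i" "r w < i" | "r u < i" "w = v" | "u = v" "r w < i"
        using cases uw by blast
      then show "Q {g u, g w}"
      proof cases
        case 1
        then show ?thesis using partial_emb uw g_old unfolding partial_emb_def by simp
      next
        case 2
        then have "Q {f u, x}" using partial_emb uw v x unfolding partial_emb_def by blast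
        then show ?thesis using 2 g_old by (simp add: g_def)
      next
        case 3
        then have "{w, v} \<in> E" using uw(3) by (simp add: insert_commute)
        then have "Q {f w, x}" using 3 partial_emb uw v x unfolding partial_emb_def by blast
        then show ?thesis using 3 g_old by (simp add: g_def insert_commute)
      qed
    next
      fix u assume u: "u \<in> V" "Suc i \<le> r u"
      show "D u \<subseteq> I u" using C(1)[of u] u by (auto simp: D_def)
      show "card V * M ^ (k + 1 - d (Suc i) u) \<le> card (D u)"
        using good[of u] d_L[of u] d_other[of u] C(3)[of u] u by (auto simp: D_def)
    next
      fix u w y assume uw: "u \<in> V" "w \<in> V" "{u, w} \<in> E" "r u < Suc i" "Suc i \<le> r w" "y \<in> D w"
      have y: "y \<in> C w" using uw(6) by (auto simp: D_def split: if_splits)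
      show "Q {g u, y}"
      proof (cases "u = v")
        case True
        then have "w \<in> L" using uw by (simp add: L_def)
        then show ?thesis using uw(6) True by (simp add: D_def g_def)
      next
        case False
        then have "r u < i" using cases uw by blast
        moreover from this have "Q {f u, y}"
          using partial_emb uw y unfolding partial_emb_def by (meson Suc_leD)
        ultimately show ?thesis using g_old by simp
      qed
    qed
    then show ?case by blast
  qed
  then obtain f C where inv_f: "partial_emb (card V) f C" by blast
  have r_less: "r v < card V" if "v \<in> V" for v
    using bij that unfolding bij_betw_def by blast
  have "f v \<in> I v" if "v \<in> V" for v
    using inv_f that r_less[OF that] by (simp add: partial_emb_def)
  moreover have "Q {f u, f v}" if "u \<in> V" "v \<in> V" "{u, v} \<in> E" for u v
    using inv_f that r_less[OF that(1)] r_less[OF that(2)] by (simp add: partial_emb_def)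
  ultimately show ?thesis by blast
qed

text \<open>Cutting \<open>S\<close> into \<open>card V\<close> consecutive blocks of size
  \<open>card V * M ^ (k + 1)\<close> accounts for the square. Without an empty pair the greedy
  embedding applies to these blocks, and placing each vertex in its own block makes the map
  increasing.\<close>

lemma embedding_or_empty_pair:
  fixes V :: "'a::linorder set" and S :: "'b::linorder set" and Q :: "'b set \<Rightarrow> bool"
  assumes "finite V" "E \<subseteq> [V]\<^bsup>2\<^esup>" "degenerate k V E" "M > 0"
    and "finite S" "card V ^ 2 * M ^ (k + 1) \<le> card S"
  obtains (embedding) f where "f \<in> V \<rightarrow> S" "strict_mono_on V f"
      "\<And>u v. u \<in> V \<Longrightarrow> v \<in> V \<Longrightarrow> {u, v} \<in> E \<Longrightarrow> Q {f u, f v}"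
    | (pair) A B where "A \<subseteq> S" "B \<subseteq> S" "card A = M" "card B = M"
      "\<And>a b. a \<in> A \<Longrightarrow> b \<in> B \<Longrightarrow> a < b" "\<And>a b. a \<in> A \<Longrightarrow> b \<in> B \<Longrightarrow> \<not> Q {a, b}"
proof (rule ccontr)
  assume "\<not> thesis"
  then have no_pair: "\<exists>a\<in>A. \<exists>b\<in>B. Q {a, b}"
    if "A \<subseteq> S" "B \<subseteq> S" "card A = M" "card B = M" "\<And>a b. a \<in> A \<Longrightarrow> b \<in> B \<Longrightarrow> a < b" for A B
    using pair[of A B] that by blast
  have "card V * (card V * M ^ (k + 1)) \<le> card S"
    using assms(6) by (simp only: power2_eq_square mult.assoc)
  from consecutive_blocks[OF assms(1,5) this]
  obtain I where "\<forall>v\<in>V. I v \<subseteq> S \<and> card (I v) = card V * M ^ (k + 1)"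
    and "\<forall>u\<in>V. \<forall>v\<in>V. u < v \<longrightarrow> (\<forall>x\<in>I u. \<forall>y\<in>I v. x < y)" by (elim exE conjE)
  then have I: "\<And>v. v \<in> V \<Longrightarrow> I v \<subseteq> S \<and> card (I v) = card V * M ^ (k + 1)"
    and I_less: "\<And>u v x y. u \<in> V \<Longrightarrow> v \<in> V \<Longrightarrow> u < v \<Longrightarrow> x \<in> I u \<Longrightarrow> y \<in> I v \<Longrightarrow> x < y"
    by simp_all
  have "\<exists>f. (\<forall>v\<in>V. f v \<in> I v) \<and> (\<forall>u\<in>V. \<forall>v\<in>V. {u, v} \<in> E \<longrightarrow> Q {f u, f v})"
  proof (rule greedy_embedding[OF assms(1-4)])
    fix u v A B
    assume uv: "u \<in> V" "v \<in> V" "u \<noteq> v"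
      and AB: "A \<subseteq> I u" "B \<subseteq> I v" "card A = M" "card B = M"
    have sub: "A \<subseteq> S" "B \<subseteq> S" using AB I uv by blast+
    show "\<exists>a\<in>A. \<exists>b\<in>B. Q {a, b}"
    proof (cases "u < v")
      case True
      then show ?thesis using no_pair[of A B] AB sub I_less[OF uv(1,2)] by blast
    next
      case False
      \<comment> \<open>The pair condition is oriented from left to right, so the two sets exchange
        roles here.\<close>
      then have "v < u" using uv(3) by simp
      then have "\<exists>b\<in>B. \<exists>a\<in>A. Q {b, a}"
        using no_pair[of B A] AB sub I_less[OF uv(2,1)] by blast
      then show ?thesis by (metis insert_commute)
    qed
  next
    show "finite (I v)" if "v \<in> V" for v using I[OF that] assms(5) finite_subset by blast
  qed (use I in auto)
  then obtain f where f: "\<And>v. v \<in> V \<Longrightarrow> f v \<in> I v"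
      "\<And>u v. u \<in> V \<Longrightarrow> v \<in> V \<Longrightarrow> {u, v} \<in> E \<Longrightarrow> Q {f u, f v}" by blast
  have "f \<in> V \<rightarrow> S" using f(1) I by blast
  moreover have "strict_mono_on V f" using f(1) I_less by (auto intro!: strict_mono_onI)
  ultimately show False using embedding f(2) \<open>\<not> thesis\<close> by blast
qed

section \<open>The recursive bound and its closed form\<close>

text \<open>The number of points that suffices for \<open>L\<close> rounds of splitting: a set of
  size \<open>ramsey_bound n k (Suc L)\<close> without a blue copy yields an empty pair with both
  sides of size \<open>ramsey_bound n k L\<close>.\<close>

primrec ramsey_bound :: "nat \<Rightarrow> nat \<Rightarrow> nat \<Rightarrow> nat" where
  "ramsey_bound n k 0 = n"
| "ramsey_bound n k (Suc L) = n ^ 2 * ramsey_bound n k L ^ (k + 1)"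

lemma ramsey_bound_pos: "n > 0 \<Longrightarrow> ramsey_bound n k L > 0"
  by (induction L) auto

text \<open>The exponent recursion \<open>e \<mapsto> (k + 1) * e + 2\<close> has fixed point
  \<open>- 2 / k\<close>. Thus \<open>e + 2 / k\<close> is multiplied by \<open>k + 1\<close> in
  each round, starting from \<open>1 + 2 / k\<close>.\<close>

lemma ramsey_bound_powr:
  assumes "n > 0" "k > 0"
  shows "real (ramsey_bound n k L) =
    real n powr ((1 + 2 / real k) * real (k + 1) ^ L - 2 / real k)"
proof (induction L)
  case 0
  then show ?case using assms by simp
next
  case (Suc L)
  let ?e = "(1 + 2 / real k) * real (k + 1) ^ L - 2 / real k"
  have "real (ramsey_bound n k (Suc L)) = real n ^ 2 * (real n powr ?e) ^ (k + 1)"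
    using Suc by simp
  also have "(real n powr ?e) ^ (k + 1) = real n powr (?e * real (k + 1))"
    using assms by (subst powr_powr[symmetric], subst powr_realpow) auto
  also have "real n ^ 2 = real n powr 2" using assms by simp
  also have "real n powr 2 * real n powr (?e * real (k + 1)) = real n powr (2 + ?e * real (k + 1))"
    by (simp add: powr_add)
  also have "2 + ?e * real (k + 1) = (1 + 2 / real k) * real (k + 1) ^ Suc L - 2 / real k"
    using assms by (simp add: field_simps)
  finally show ?case .
qed

section \<open>Red multipartite graphs by repeated splitting\<close>

text \<open>The graph whose blue copy is excluded stays all of \<open>V\<close>, whereas
  \<open>W\<close>, the vertices still to be placed, is split with the colours: the lower half of
  the colours goes into \<open>A\<close>, the upper half into \<open>B\<close>. The exclusion of
  blue copies passes to subsets of \<open>S\<close>, so the induction varies \<open>S\<close>,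
  \<open>W\<close> and \<open>c\<close>.\<close>

lemma embedding_or_multipartite:
  fixes V :: "'a::linorder set" and S :: "'b::linorder set" and Q :: "'b set \<Rightarrow> bool"
  assumes V: "finite V" "E \<subseteq> [V]\<^bsup>2\<^esup>" "degenerate k V E" "V \<noteq> {}"
    and S: "finite S" "ramsey_bound (card V) k L \<le> card S"
    and no_embedding: "\<nexists>f. f \<in> V \<rightarrow> S \<and> strict_mono_on V f \<and>
      (\<forall>u\<in>V. \<forall>v\<in>V. {u, v} \<in> E \<longrightarrow> Q {f u, f v})"
    and c: "W \<subseteq> V" "mono_on W c" "c ` W \<subseteq> {..<2 ^ L :: nat}"
  shows "\<exists>f. f \<in> W \<rightarrow> S \<and> strict_mono_on W f \<and>
    (\<forall>u\<in>W. \<forall>v\<in>W. c u \<noteq> c v \<longrightarrow> \<not> Q {f u, f v})"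
  using S no_embedding c
proof (induction L arbitrary: S W c)
  case 0
  \<comment> \<open>With a single colour there is nothing to avoid, and any increasing map into
    \<open>S\<close> will do; blocks of size 1 provide one.\<close>
  have "card W * 1 \<le> card S" using 0 card_mono[OF V(1) \<open>W \<subseteq> V\<close>] by simp
  from consecutive_blocks[OF finite_subset[OF \<open>W \<subseteq> V\<close> V(1)] \<open>finite S\<close> this]
  obtain I where "\<forall>v\<in>W. I v \<subseteq> S \<and> card (I v) = 1"
    and "\<forall>u\<in>W. \<forall>v\<in>W. u < v \<longrightarrow> (\<forall>x\<in>I u. \<forall>y\<in>I v. x < y)" by (elim exE conjE)
  then have I: "\<And>v. v \<in> W \<Longrightarrow> I v \<subseteq> S \<and> card (I v) = 1"
      "\<And>u v x y. u \<in> W \<Longrightarrow> v \<in> W \<Longrightarrow> u < v \<Longrightarrow> x \<in> I u \<Longrightarrow> y \<in> I v \<Longrightarrow> x < y"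
    by simp_all
  have "\<forall>v\<in>W. \<exists>x. x \<in> I v" using I(1) by (metis all_not_in_conv card.empty zero_neq_one)
  then obtain f where f: "\<And>v. v \<in> W \<Longrightarrow> f v \<in> I v" by metis
  have "f \<in> W \<rightarrow> S" using f I(1) by blast
  moreover have "strict_mono_on W f" using f I(2) by (auto intro!: strict_mono_onI)
  moreover have "\<forall>u\<in>W. \<forall>v\<in>W. c u = c v"
  proof -
    have "c v = 0" if "v \<in> W" for v
      using that \<open>c ` W \<subseteq> {..<2 ^ 0}\<close> by (auto simp: image_subset_iff)
    then show ?thesis by simp
  qed
  ultimately show ?case by blast
next
  case (Suc L)
  let ?M = "ramsey_bound (card V) k L"
  have "?M > 0" using V by (intro ramsey_bound_pos) (simp add: card_gt_0_iff)
  have bound: "card V ^ 2 * ?M ^ (k + 1) \<le> card S" using Suc.prems(2) by simp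
  obtain A B where AB: "A \<subseteq> S" "B \<subseteq> S" "card A = ?M" "card B = ?M"
      and less: "\<And>a b. a \<in> A \<Longrightarrow> b \<in> B \<Longrightarrow> a < b"
      and red: "\<And>a b. a \<in> A \<Longrightarrow> b \<in> B \<Longrightarrow> \<not> Q {a, b}"
  proof (cases rule: embedding_or_empty_pair[OF V(1-3) \<open>?M > 0\<close> Suc.prems(1) bound,
      where Q = Q, case_names embedding pair])
    case (embedding f)
    then show ?thesis using Suc.prems(3) by blast
  next
    case (pair A B)
    then show ?thesis by (rule that)
  qed
  have no_embedding: "\<nexists>f. f \<in> V \<rightarrow> T \<and> strict_mono_on V f \<and>
      (\<forall>u\<in>V. \<forall>v\<in>V. {u, v} \<in> E \<longrightarrow> Q {f u, f v})" if "T \<subseteq> S" for T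
    using Suc.prems(3) that by blast
  \<comment> \<open>Monotonicity of \<open>c\<close> puts \<open>W1\<close> before
    \<open>W2\<close>, matching the position of \<open>A\<close> before \<open>B\<close>.\<close>
  define W1 where "W1 = {v\<in>W. c v < 2 ^ L}"
  define W2 where "W2 = {v\<in>W. 2 ^ L \<le> c v}"
  have W: "v \<in> W1 \<or> v \<in> W2" if "v \<in> W" for v using that by (auto simp: W1_def W2_def)
  have W12: "u < v" if "u \<in> W1" "v \<in> W2" for u v
  proof (rule ccontr)
    assume "\<not> u < v"
    then have "c v \<le> c u"
      using that Suc.prems(5) by (intro mono_onD[of W c]) (auto simp: W1_def W2_def)
    then show False using that by (simp add: W1_def W2_def)
  qed
  have "finite A" "finite B" using AB Suc.prems(1) finite_subset by blast+
  have W_sub: "W1 \<subseteq> V" "W2 \<subseteq> V" using Suc.prems(4) by (auto simp: W1_def W2_def)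
  have "mono_on W1 c" "c ` W1 \<subseteq> {..<2 ^ L}"
    using Suc.prems(5) by (auto simp: W1_def mono_on_def)
  from Suc.IH[OF \<open>finite A\<close> eq_refl[OF AB(3)[symmetric]] no_embedding[OF AB(1)] W_sub(1) this]
  obtain f where f: "f \<in> W1 \<rightarrow> A" "strict_mono_on W1 f"
      "\<And>u v. u \<in> W1 \<Longrightarrow> v \<in> W1 \<Longrightarrow> c u \<noteq> c v \<Longrightarrow> \<not> Q {f u, f v}"
    by blast
  \<comment> \<open>On \<open>W2\<close> all colours are at least \<open>2 ^ L\<close>, so the shift
    does not truncate and keeps distinct colours distinct.\<close>
  have "mono_on W2 (\<lambda>v. c v - 2 ^ L)"
    using mono_onD[OF Suc.prems(5)] by (intro mono_onI diff_le_mono) (simp add: W2_def)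
  moreover have "c v - 2 ^ L < 2 ^ L" if "v \<in> W2" for v
  proof -
    have "c v < 2 ^ Suc L" using that Suc.prems(6) by (auto simp: W2_def)
    then show ?thesis using that by (simp add: W2_def)
  qed
  then have "(\<lambda>v. c v - 2 ^ L) ` W2 \<subseteq> {..<2 ^ L}" by blast
  ultimately obtain g where g: "g \<in> W2 \<rightarrow> B" "strict_mono_on W2 g"
      "\<And>u v. u \<in> W2 \<Longrightarrow> v \<in> W2 \<Longrightarrow> c u - 2 ^ L \<noteq> c v - 2 ^ L \<Longrightarrow> \<not> Q {g u, g v}"
    using Suc.IH[OF \<open>finite B\<close> eq_refl[OF AB(4)[symmetric]] no_embedding[OF AB(2)] W_sub(2),
      of "\<lambda>v. c v - 2 ^ L"] by blast
  define h where "h v = (if v \<in> W1 then f v else g v)" for v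
  have h1: "h v = f v" "f v \<in> A" if "v \<in> W1" for v using that f(1) by (auto simp: h_def)
  have h2: "h v = g v" "g v \<in> B" if "v \<in> W2" for v
    using that g(1) by (auto simp: h_def W1_def W2_def)
  have "h v \<in> S" if "v \<in> W" for v
    using W[OF that]
  proof
    assume "v \<in> W1"
    then show ?thesis using h1 AB(1) by (metis subsetD)
  next
    assume "v \<in> W2"
    then show ?thesis using h2 AB(2) by (metis subsetD)
  qed
  then have "h \<in> W \<rightarrow> S" by (rule Pi_I)
  moreover have "strict_mono_on W h"
  proof (rule strict_mono_onI)
    fix u v assume uv: "u \<in> W" "v \<in> W" "u < v"
    then consider "u \<in> W1" "v \<in> W1" | "u \<in> W1" "v \<in> W2" | "u \<in> W2" "v \<in> W2"
      using W[OF uv(1)] W[OF uv(2)] W12[of v u] order_less_asym[OF uv(3)] by blast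
    then show "h u < h v"
    proof cases
      case 1
      then show ?thesis using strict_mono_onD[OF f(2) _ _ uv(3)] by (simp add: h1(1))
    next
      case 2
      then show ?thesis using less[OF h1(2) h2(2)] by (simp add: h1(1) h2(1))
    next
      case 3
      then show ?thesis using strict_mono_onD[OF g(2) _ _ uv(3)] by (simp add: h2(1))
    qed
  qed
  moreover have "\<not> Q {h u, h v}" if uv: "u \<in> W" "v \<in> W" "c u \<noteq> c v" for u v
  proof -
    consider "u \<in> W1" "v \<in> W1" | "u \<in> W1" "v \<in> W2" | "u \<in> W2" "v \<in> W1" | "u \<in> W2" "v \<in> W2"
      using W uv by blast
    then show ?thesis
    proof cases
      case 3
      then show ?thesis using red[of "f v" "g u"] h1 h2 by (simp add: insert_commute)
    next
      case 4
      then have "c u - 2 ^ L \<noteq> c v - 2 ^ L" using uv(3) by (auto simp: W2_def)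
      then show ?thesis using 4 g(3) h2 by simp
    qed (use h1 h2 red f(3) uv(3) in auto)
  qed
  ultimately show ?case by blast
qed

section \<open>Interval colourings as monotone functions\<close>

text \<open>Ensures that the minimum defining \<open>interval_chromatic_number\<close> is
  attained.\<close>

lemma interval_colouring_singletons:
  assumes "E \<subseteq> [V]\<^bsup>2\<^esup>"
  shows "interval_colouring V E ((\<lambda>v. {v}) ` V)"
  unfolding interval_colouring_def
proof (intro conjI ballI)
  show "partition_on V ((\<lambda>v. {v}) ` V)"
    by (auto simp: partition_on_def disjoint_def)
  fix I assume I: "I \<in> (\<lambda>v. {v}) ` V"
  then show "vertex_interval V I" by (auto simp: vertex_interval_def)
  show "\<not> e \<subseteq> I" if "e \<in> E" for e
    using that I assms by (auto simp: subset_iff elim!: nsets2_E)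
qed

text \<open>The parts are numbered by letting \<open>c v\<close> count the parts that lie entirely
  before \<open>v\<close>. The part of \<open>v\<close> is not among them, so the values stay below
  \<open>card P\<close>. For an edge with \<open>u < v\<close>, the part of \<open>u\<close> is
  counted for \<open>v\<close> but not for \<open>u\<close>.\<close>

lemma interval_colouring_mono_function:
  assumes "finite V" "E \<subseteq> [V]\<^bsup>2\<^esup>" "interval_colouring V E P"
  obtains c :: "'a::linorder \<Rightarrow> nat" where "mono_on V c" "c ` V \<subseteq> {..<card P}"
    "\<And>u v. {u, v} \<in> E \<Longrightarrow> c u \<noteq> c v"
proof -
  have P: "partition_on V P" "\<And>I. I \<in> P \<Longrightarrow> vertex_interval V I"
      "\<And>I e. I \<in> P \<Longrightarrow> e \<in> E \<Longrightarrow> \<not> e \<subseteq> I"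
    using assms(3) by (auto simp: interval_colouring_def)
  have finP: "finite P" using P(1) assms(1) finite_elements by blast
  define b where "b v = {J\<in>P. \<forall>x\<in>J. x < v}" for v
  have b_mono: "b u \<subseteq> b v" if "u \<le> v" for u v
    using that by (auto simp: b_def)
  have finb: "finite (b v)" for v using finP by (simp add: b_def)
  have part: "\<exists>I\<in>P. v \<in> I" if "v \<in> V" for v
    using that P(1) by (auto simp: partition_on_def)
  have "mono_on V (\<lambda>v. card (b v))"
    using b_mono finb by (intro mono_onI card_mono)
  moreover have "card (b v) < card P" if "v \<in> V" for v
    using part[OF that] finP by (intro psubset_card_mono) (auto simp: b_def)
  moreover have less: "card (b u) \<noteq> card (b v)" if uv: "{u, v} \<in> E" "u < v" for u v
  proof
    assume eq: "card (b u) = card (b v)"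
    have V: "u \<in> V" "v \<in> V" using uv assms(2) by (auto simp: nsets_def)
    have b_eq: "b u = b v" using card_subset_eq[OF finb b_mono eq] uv by simp
    obtain I where I: "I \<in> P" "u \<in> I" using part V by blast
    have "v \<notin> I" using P(3)[OF I(1) uv(1)] I(2) by simp
    \<comment> \<open>Otherwise \<open>v\<close> would lie between \<open>u\<close> and
      \<open>x\<close>, hence in the interval \<open>I\<close>, which then would contain an
      edge.\<close>
    have "x < v" if "x \<in> I" for x
    proof (rule ccontr)
      assume "\<not> x < v"
      then have "v < x" using \<open>v \<notin> I\<close> that by (metis linorder_neqE)
      then show False
        using P(2)[OF I(1)] I(2) that uv(2) V(2) \<open>v \<notin> I\<close> unfolding vertex_interval_def by blast
    qed
    then have "I \<in> b v" using I(1) by (simp add: b_def)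
    moreover have "I \<notin> b u" using I(2) by (auto simp: b_def)
    ultimately show False using b_eq by simp
  qed
  moreover have "card (b u) \<noteq> card (b v)" if uv: "{u, v} \<in> E" for u v
  proof -
    have "u \<noteq> v" using uv assms(2) by (auto simp: nsets_def)
    then show ?thesis using less[of u v] less[of v u] uv
      by (metis insert_commute linorder_neqE)
  qed
  ultimately show thesis by (intro that[of "\<lambda>v. card (b v)"]) auto
qed

section \<open>The bound on the ordered Ramsey number\<close>

theorem theorem7:
  fixes V :: "'a::linorder set" and E :: "'a set set" and k p n :: nat
  assumes "k > 0" and "p > 0"
    and "ordered_graph V E"
    and "degenerate k V E"
    and "card V = n"
    and "interval_chromatic_number V E = p"
  shows "real (ordered_ramsey_number V E 2)
    \<le> real n powr ((1 + 2 / real k) * real (k + 1) ^ nat \<lceil>log 2 (real p)\<rceil> - 2 / real k)"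
proof -
  have V: "finite V" and E: "E \<subseteq> [V]\<^bsup>2\<^esup>"
    using assms(3) by (auto simp: ordered_graph_def)
  have "\<exists>P. interval_colouring V E P \<and> card P = p"
    unfolding assms(6)[symmetric] interval_chromatic_number_def
    by (rule LeastI_ex) (use interval_colouring_singletons[OF E] in blast)
  then obtain P where P: "interval_colouring V E P" "card P = p" by blast
  obtain c :: "'a \<Rightarrow> nat" where c: "mono_on V c" "c ` V \<subseteq> {..<p}"
      "\<And>u v. {u, v} \<in> E \<Longrightarrow> c u \<noteq> c v"
    using interval_colouring_mono_function[OF V E P(1)] P(2) by metis
  \<comment> \<open>The empty set has only the empty partition, which would force
    \<open>p = 0\<close>.\<close>
  have "V \<noteq> {}"
    using P \<open>p > 0\<close> by (auto simp: interval_colouring_def partition_on_empty)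
  then have "n > 0" using V assms(5) by (auto simp: card_gt_0_iff)
  define L where "L = nat \<lceil>log 2 (real p)\<rceil>"
  have "real p \<le> 2 powr real L"
    using \<open>p > 0\<close> unfolding L_def by (subst log_le_iff[symmetric]) linarith+
  then have "real p \<le> real (2 ^ L)" by (simp add: powr_realpow)
  then have "p \<le> 2 ^ L" by (simp only: of_nat_le_iff)
  then have cL: "c ` V \<subseteq> {..<2 ^ L}" using c(2) by force
  let ?N = "ramsey_bound n k L"
  have "ordered_ramsey_arrow ?N V E 2"
    unfolding ordered_ramsey_arrow_def
  proof
    fix \<chi> assume \<chi>: "\<chi> \<in> [{..<?N}]\<^bsup>2\<^esup> \<rightarrow> {..<2 :: nat}"
    \<comment> \<open>The host is complete, so every increasing map is an ordered copy and only the
      colours of its edges matter.\<close>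
    have copy: "ordered_copy f V E {..<?N} ([{..<?N}]\<^bsup>2\<^esup>)"
      if f: "f \<in> V \<rightarrow> {..<?N}" "strict_mono_on V f" for f :: "'a \<Rightarrow> nat"
    proof -
      have inj: "inj_on f V" using f(2) by (rule strict_mono_on_imp_inj_on)
      have "f ` e \<in> [{..<?N}]\<^bsup>2\<^esup>" if e: "e \<in> E" for e
      proof -
        obtain u v where uv: "u \<in> V" "v \<in> V" "u \<noteq> v" "e = {u, v}"
          using e E by (blast elim: nsets2_E)
        then have "f u \<noteq> f v" using inj by (auto dest: inj_onD)
        then show ?thesis using uv f(1) by auto
      qed
      then show ?thesis using f inj by (auto simp: ordered_copy_def)
    qed
    have edge: "\<exists>u\<in>V. \<exists>v\<in>V. e = {u, v}" if "e \<in> E" for e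
      using that E by (blast elim: nsets2_E)
    show "\<exists>f. \<exists>c<2. ordered_copy f V E {..<?N} ([{..<?N}]\<^bsup>2\<^esup>) \<and> (\<forall>e\<in>E. \<chi> (f ` e) = c)"
    \<comment> \<open>Colour 0 is blue. If it has no copy, the red multipartite graph contains one,
      because \<open>c\<close> separates the ends of every edge.\<close>
    proof (cases "\<exists>f. f \<in> V \<rightarrow> {..<?N} \<and> strict_mono_on V f \<and>
        (\<forall>u\<in>V. \<forall>v\<in>V. {u, v} \<in> E \<longrightarrow> \<chi> {f u, f v} = 0)")
      case True
      then obtain f where f: "f \<in> V \<rightarrow> {..<?N}" "strict_mono_on V f"
          "\<And>u v. u \<in> V \<Longrightarrow> v \<in> V \<Longrightarrow> {u, v} \<in> E \<Longrightarrow> \<chi> {f u, f v} = 0" by blast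
      have "\<chi> (f ` e) = 0" if "e \<in> E" for e
        using edge[OF that] that f(3) by auto
      then show ?thesis using copy[OF f(1,2)] by (intro exI[of _ f] exI[of _ 0]) simp
    next
      case False
      then obtain f where f: "f \<in> V \<rightarrow> {..<?N}" "strict_mono_on V f"
          "\<And>u v. u \<in> V \<Longrightarrow> v \<in> V \<Longrightarrow> c u \<noteq> c v \<Longrightarrow> \<chi> {f u, f v} \<noteq> 0"
        using embedding_or_multipartite[OF V E assms(4) \<open>V \<noteq> {}\<close>, of "{..<?N}" L "\<lambda>e. \<chi> e = 0" V c]
          assms(5) c(1) cL by auto
      have "\<chi> (f ` e) = 1" if e: "e \<in> E" for e
      proof -
        have "f ` e \<in> [{..<?N}]\<^bsup>2\<^esup>" using copy[OF f(1,2)] e by (simp add: ordered_copy_def)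
        then have "\<chi> (f ` e) < 2" using \<chi> by blast
        moreover have "\<chi> (f ` e) \<noteq> 0" using edge[OF e] e f(3) c(3) by auto
        ultimately show ?thesis by simp
      qed
      then show ?thesis using copy[OF f(1,2)] by (intro exI[of _ f] exI[of _ 1]) simp
    qed
  qed
  then have "ordered_ramsey_number V E 2 \<le> ?N"
    unfolding ordered_ramsey_number_def by (rule Least_le)
  then have "real (ordered_ramsey_number V E 2) \<le> real ?N" by simp
  also have "\<dots> = real n powr ((1 + 2 / real k) * real (k + 1) ^ L - 2 / real k)"
    by (rule ramsey_bound_powr[OF \<open>n > 0\<close> \<open>k > 0\<close>])
  finally show ?thesis unfolding L_def .
qed

end
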